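(* The groups $M_5 \leq SL_5(\mathbb{R})$ and $M_6 \leq SL_6(\mathbb{R})$ given by $$M_5=\left\{\begin{pmatrix} 1 & a & 0 & \frac{a^2}{2} & b\\ 0 & 1 & 0 & a & 0\\ 0 & 0 & 1 & c & d\\ 0&0&0&1&0\\ 0&0&0&0&1\end{pmatrix} : a,b,c,d\in\mathbb{R}\right\},\qquad M_6=\left\{\begin{pmatrix} 1 & a & \frac{a^2}{2} & 0 & b & c\\ 0&1&a&0&0&0\\ 0&0&1&0&0&0\\ 0&0&0&1&d&e\\ 0&0&0&0&1&0\\ 0&0&0&0&0&1\end{pmatrix} : a,b,c,d,e\in\mathbb{R}\right\}$$ are abelian groups of dimension $4$ and $5$ respectively, and, for $k=5,6$, $M_k$ is not a conjugacy limit of the positive diagonal Cartan subgroup $C$ of $SL_k(\mathbb{R})$.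
   Context: $C \leq SL_k(\mathbb{R})$ is the group of positive diagonal matrices of determinant $1$. A sequence of closed subgroups $H_r\leq SL_k(\mathbb{R})$ converges (in the Chabauty topology) to a closed subgroup $H$ iff (a) every $h\in H$ is the limit of some sequence $h_r\in H_r$, and (b) whenever $h_r \in H_r$ and a subsequence of $(h_r)$ converges to $h$, then $h\in H$. A subgroup $L$ is a conjugacy limit of $C$ if there is a sequence $P_r\in SL_k(\mathbb{R})$ such that $P_r C P_r^{-1} \to L$ in the Chabauty topology. *)

theory Defs
  imports "HOL-Analysis.Analysis" "HOL-Algebra.Group"
begin

definition SL :: "(real^'n^'n) monoid" where
  "SL = \<lparr>carrier = {A. det A = 1}, mult = (**), one = mat 1\<rparr>"

lemma group_SL: "group (SL :: (real^'n^'n) monoid)"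
proof (rule groupI)
  fix A :: "real^'n^'n"
  assume "A \<in> carrier SL"
  then have d: "det A = 1"
    by (simp add: SL_def)
  then have "invertible A"
    by (simp add: invertible_det_nz)
  then obtain B where B: "A ** B = mat 1" "B ** A = mat 1"
    by (auto simp: invertible_def)
  then have "det A * det B = 1"
    by (metis det_I det_mul)
  with d B show "\<exists>B \<in> carrier SL. B \<otimes>\<^bsub>SL\<^esub> A = \<one>\<^bsub>SL\<^esub>"
    by (auto simp: SL_def)
qed (auto simp: SL_def det_mul matrix_mul_assoc)

definition positive_diagonal :: "(real^'n^'n) set" where
  "positive_diagonal =
     {A \<in> carrier SL. (\<forall>i j. i \<noteq> j \<longrightarrow> A $ i $ j = 0) \<and> (\<forall>i. A $ i $ i > 0)}"

definition conjugate :: "real^'n^'n \<Rightarrow> (real^'n^'n) set \<Rightarrow> (real^'n^'n) set" where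
  "conjugate P H = (\<lambda>A. P ** A ** matrix_inv P) ` H"

text \<open>Intended for closed subgroups of \<open>SL\<close>. As \<open>SL\<close> is closed in the space of all matrices,
  limits may be taken there. Closedness of \<open>L\<close> follows from the two conditions and so need not
  be demanded separately.\<close>

definition chabauty_converges :: "(nat \<Rightarrow> (real^'n^'n) set) \<Rightarrow> (real^'n^'n) set \<Rightarrow> bool" where
  "chabauty_converges H L \<longleftrightarrow>
     (\<forall>h\<in>L. \<exists>s. (\<forall>r. s r \<in> H r) \<and> s \<longlonglongrightarrow> h) \<and>
     (\<forall>s h. (\<forall>r. s r \<in> H r) \<and> (\<exists>\<phi>. strict_mono \<phi> \<and> (s \<circ> \<phi>) \<longlonglongrightarrow> h) \<longrightarrow> h \<in> L)"

definition conjugacy_limit :: "(real^'n^'n) set \<Rightarrow> (real^'n^'n) set \<Rightarrow> bool" where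
  "conjugacy_limit C L \<longleftrightarrow>
     (\<exists>P. (\<forall>r. P r \<in> carrier SL) \<and> chabauty_converges (\<lambda>r. conjugate (P r) C) L)"

text \<open>A closed subgroup of \<open>SL\<close> is an embedded Lie subgroup, so its dimension is the
  dimension of its subspace topology as a topological manifold. Hausdorffness and second
  countability are inherited from the space of matrices, and \<open>n\<close> is unique by invariance of
  domain.\<close>

definition has_lie_dimension :: "(real^'n^'n) set \<Rightarrow> nat \<Rightarrow> bool" where
  "has_lie_dimension H n \<longleftrightarrow>
     subgroup H SL \<and> closedin (top_of_set (carrier SL)) H \<and>
     (\<forall>x\<in>H. \<exists>U V. openin (top_of_set H) U \<and> x \<in> U \<and> openin (Euclidean_space n) V \<and>
        top_of_set U homeomorphic_space subtopology (Euclidean_space n) V)"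

definition M5 :: "(real^5^5) set" where
  "M5 = {vector [vector [1, a, 0, a\<^sup>2 / 2, b],
                 vector [0, 1, 0, a,       0],
                 vector [0, 0, 1, c,       d],
                 vector [0, 0, 0, 1,       0],
                 vector [0, 0, 0, 0,       1]] | a b c d. True}"

definition M6 :: "(real^6^6) set" where
  "M6 = {vector [vector [1, a, a\<^sup>2 / 2, 0, b, c],
                 vector [0, 1, a,       0, 0, 0],
                 vector [0, 0, 1,       0, 0, 0],
                 vector [0, 0, 0,       1, d, e],
                 vector [0, 0, 0,       0, 1, 0],
                 vector [0, 0, 0,       0, 0, 1]] | a b c d e. True}"

end

(* The linear span of the Cartan subgroup C of SL_k consists of the diagonal matrices, so every
   conjugate of C spans a space of dimension at most k. Linear independence is an open condition,
   hence every conjugacy limit of C also spans at most k dimensions. The entries of M_5 involve the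
   six linearly independent functions 1, a, a^2/2, b, c, d, and those of M_6 the seven functions
   1, a, a^2/2, b, c, d, e, so these groups span too much. *)
theory Submission
  imports Defs
begin

section \<open>Spans of conjugacy limits\<close>

text \<open>A vector \<open>x\<close> killed by the map would satisfy
  \<open>norm x = norm (T x) \<le> norm x / 2\<close>, so the kernel is trivial. This is the
  quantitative form in which small perturbations of the identity stay injective.\<close>

lemma linear_perturbation_inj:
  fixes T :: "'a::real_normed_vector \<Rightarrow> 'a"
  assumes "linear T" and small: "\<And>x. norm (T x) \<le> norm x / 2"
  shows "inj (\<lambda>x. x + T x)"
proof -
  have "linear (\<lambda>x. x + T x)"
    by (intro linear_compose_add linear_id[unfolded id_def] assms(1))
  moreover have "x = 0" if "x + T x = 0" for x
  proof -
    have "norm x = norm (T x)"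
      using that by (metis add_eq_0_iff norm_minus_cancel)
    with small[of x] show ?thesis by simp
  qed
  ultimately show ?thesis
    using linear_injective_0 by blast
qed

text \<open>The assignment of \<open>s b r\<close> to \<open>b\<close> extends from \<open>B\<close>
  to a linear map of the whole space that tends to the identity. Once it is close enough to be
  injective, it carries \<open>B\<close> to an independent set of the same size.\<close>

lemma independent_eventually:
  fixes B :: "'a::euclidean_space set" and s :: "'a \<Rightarrow> nat \<Rightarrow> 'a"
  assumes B: "independent B" and s: "\<And>b. b \<in> B \<Longrightarrow> s b \<longlonglongrightarrow> b"
  shows "eventually (\<lambda>r. inj_on (\<lambda>b. s b r) B \<and> independent ((\<lambda>b. s b r) ` B)) sequentially"
proof -
  have finB: "finite B"
    using B independent_bound by blast
  \<comment> \<open>The functionals \<open>g b\<close> for \<open>b\<close> in \<open>B\<close> are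
    dual to \<open>B\<close>: they pick out coefficients with respect to \<open>B\<close> on its
    span.\<close>
  have "\<forall>b. \<exists>g :: 'a \<Rightarrow> real. linear g \<and> (\<forall>x\<in>B. g x = (if x = b then 1 else 0))"
    by (rule allI, rule linear_independent_extend[OF B])
  then obtain g :: "'a \<Rightarrow> 'a \<Rightarrow> real"
    where g: "\<And>b. linear (g b)" "\<And>b x. x \<in> B \<Longrightarrow> g b x = (if x = b then 1 else 0)"
    by (simp only: choice_iff) blast
  have "\<exists>K. \<forall>x. \<bar>g b x\<bar> \<le> norm x * K" for b
    using bounded_linear.nonneg_bounded[OF linear_conv_bounded_linear[THEN iffD1, OF g(1)]]
    by auto
  then obtain K where K: "\<And>b x. \<bar>g b x\<bar> \<le> norm x * K b"
    by metis
  have "(\<lambda>r. \<Sum>b\<in>B. K b * norm (s b r - b)) \<longlonglongrightarrow> (\<Sum>b\<in>B. K b * norm (b - b))"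
    by (intro tendsto_intros s)
  then have "(\<lambda>r. \<Sum>b\<in>B. K b * norm (s b r - b)) \<longlonglongrightarrow> 0"
    by simp
  \<comment> \<open>The sum bounds the operator norm of the perturbation \<open>T\<close> below, and
    1/2 is the threshold in \<open>linear_perturbation_inj\<close>.\<close>
  then have "eventually (\<lambda>r. (\<Sum>b\<in>B. K b * norm (s b r - b)) < 1/2) sequentially"
    by (rule order_tendstoD) simp
  then show ?thesis
  proof eventually_elim
    case (elim r)
    \<comment> \<open>\<open>T\<close> is built so that \<open>b + T b = s b r\<close> for every
      \<open>b\<close> in \<open>B\<close>.\<close>
    define T where "T x = (\<Sum>b\<in>B. g b x *\<^sub>R (s b r - b))" for x
    have lin: "linear T"
      unfolding T_def
      by (rule linearI) (simp_all add: linear_add[OF g(1)] linear_scale[OF g(1)]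
          scaleR_add_left sum.distrib scaleR_sum_right)
    have "norm (T x) \<le> norm x / 2" for x
    proof -
      have "norm (T x) \<le> (\<Sum>b\<in>B. \<bar>g b x\<bar> * norm (s b r - b))"
        unfolding T_def by (rule order_trans[OF norm_sum]) simp
      also have "\<dots> \<le> (\<Sum>b\<in>B. norm x * K b * norm (s b r - b))"
        by (intro sum_mono mult_right_mono K) simp
      also have "\<dots> = norm x * (\<Sum>b\<in>B. K b * norm (s b r - b))"
        by (simp add: sum_distrib_left mult.assoc)
      also have "\<dots> \<le> norm x * (1/2)"
        using elim by (intro mult_left_mono) auto
      finally show ?thesis by simp
    qed
    from linear_perturbation_inj[OF lin this] have inj: "inj (\<lambda>x. x + T x)" .
    have linT: "linear (\<lambda>x. x + T x)"
      by (intro linear_compose_add linear_id[unfolded id_def] lin)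
    have T: "b + T b = s b r" if "b \<in> B" for b
    proof -
      have "T b = (\<Sum>c\<in>B. if c = b then s b r - b else 0)"
        unfolding T_def by (rule sum.cong) (use that in \<open>auto simp: g(2)\<close>)
      then show ?thesis
        using that finB by simp
    qed
    have "independent ((\<lambda>x. x + T x) ` B)"
      using linear_independent_injective_image[OF linT B inj_on_subset[OF inj]] by blast
    moreover have "inj_on (\<lambda>x. x + T x) B"
      using inj by (rule inj_on_subset) simp
    ultimately show ?case
      using T by (simp cong: image_cong inj_on_cong)
  qed
qed

text \<open>A basis of the span of \<open>L\<close> can be chosen inside \<open>L\<close>.
  Approximating its elements from \<open>H r\<close> gives, for some \<open>r\<close>, equally many
  independent elements of \<open>H r\<close>.\<close>

lemma dim_limit_le:
  fixes L :: "'a::euclidean_space set"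
  assumes lim: "\<And>h. h \<in> L \<Longrightarrow> \<exists>s. (\<forall>r. s r \<in> H r) \<and> s \<longlonglongrightarrow> h"
    and dim: "\<And>r. dim (H r) \<le> n"
  shows "dim L \<le> n"
proof -
  obtain B where B: "B \<subseteq> L" "independent B" "card B = dim L"
    using basis_exists[of L] by metis
  obtain s where s: "\<And>h r. h \<in> L \<Longrightarrow> s h r \<in> H r" "\<And>h. h \<in> L \<Longrightarrow> s h \<longlonglongrightarrow> h"
    using lim by metis
  have "eventually (\<lambda>r. inj_on (\<lambda>b. s b r) B \<and> independent ((\<lambda>b. s b r) ` B)) sequentially"
    using B by (intro independent_eventually) (auto intro: s(2))
  then obtain r where "inj_on (\<lambda>b. s b r) B" "independent ((\<lambda>b. s b r) ` B)"
    using eventually_happens'[OF sequentially_bot] by blast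
  moreover have "(\<lambda>b. s b r) ` B \<subseteq> H r"
    using B s(1) by auto
  ultimately have "card B \<le> dim (H r)"
    using independent_card_le_dim by (metis card_image)
  with dim[of r] B show ?thesis by simp
qed

section \<open>Conjugates of the diagonal group and their limits\<close>

lemma dim_positive_diagonal_le: "dim (positive_diagonal :: (real^'n^'n) set) \<le> CARD('n)"
proof -
  let ?d = "\<lambda>v::real^'n. (\<chi> i j. if i = j then v $ i else 0) :: real^'n^'n"
  have lin: "linear ?d"
    by (rule linearI) (simp_all add: vec_eq_iff)
  have "A \<in> range ?d" if "A \<in> positive_diagonal" for A
    by (rule image_eqI[of _ _ "\<chi> i. A $ i $ i"])
      (use that in \<open>auto simp: positive_diagonal_def vec_eq_iff\<close>)
  then have "dim (positive_diagonal :: (real^'n^'n) set) \<le> dim (range ?d)"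
    by (intro dim_subset) auto
  also have "\<dots> \<le> dim (UNIV :: (real^'n) set)"
    by (rule dim_image_le[OF lin])
  finally show ?thesis by simp
qed

text \<open>Conjugation by \<open>P\<close> is the restriction of a linear map on the full matrix
  space, and linear maps do not raise dimension.\<close>

lemma dim_conjugate_le: "dim (conjugate P H) \<le> dim H"
proof -
  have "linear (\<lambda>A. P ** A ** matrix_inv P)"
    by (rule linearI)
      (simp_all add: vec_eq_iff matrix_matrix_mult_def algebra_simps sum.distrib sum_distrib_left)
  then show ?thesis
    unfolding conjugate_def by (rule dim_image_le)
qed

lemma dim_conjugacy_limit_le:
  fixes L :: "(real^'n^'n) set"
  assumes "conjugacy_limit positive_diagonal L"
  shows "dim L \<le> CARD('n)"
proof -
  obtain P where "chabauty_converges (\<lambda>r. conjugate (P r) positive_diagonal) L"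
    using assms unfolding conjugacy_limit_def by blast
  then have "\<And>h. h \<in> L \<Longrightarrow>
      \<exists>s. (\<forall>r. s r \<in> conjugate (P r) positive_diagonal) \<and> s \<longlonglongrightarrow> h"
    unfolding chabauty_converges_def by blast
  then show ?thesis
    by (rule dim_limit_le) (assumption, rule order_trans[OF dim_conjugate_le dim_positive_diagonal_le])
qed

lemma dim_ge_of_no_linear_relation:
  fixes f :: "'a::euclidean_space \<Rightarrow> 'b::euclidean_space"
  assumes "linear f" and rel: "\<And>v. (\<And>x. x \<in> S \<Longrightarrow> v \<bullet> f x = 0) \<Longrightarrow> v = 0"
  shows "DIM('b) \<le> dim S"
proof -
  have "span (f ` S) = UNIV"
    using span_not_UNIV_orthogonal[of "f ` S"] rel span_base by blast
  then have "dim (f ` S) = DIM('b)"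
    by (simp add: dim_eq_full)
  then show ?thesis
    using dim_image_le[OF assms(1), of S] by simp
qed

section \<open>Groups parametrised by a Euclidean space\<close>

text \<open>If all factors \<open>A $ i $ p i\<close> of a Leibniz term are nonzero, then \<open>p\<close> does not decrease
  \<open>\<rho>\<close>; since it preserves the sum of \<open>\<rho>\<close>, it preserves \<open>\<rho>\<close> and hence is the identity.\<close>

lemma det_unitriangular:
  fixes A :: "'a::comm_ring_1^'n^'n" and \<rho> :: "'n \<Rightarrow> nat"
  assumes diag: "\<And>i. A $ i $ i = 1"
    and tri: "\<And>i j. i \<noteq> j \<Longrightarrow> \<rho> j \<le> \<rho> i \<Longrightarrow> A $ i $ j = 0"
  shows "det A = 1"
proof -
  let ?t = "\<lambda>p. of_int (sign p) * (\<Prod>i\<in>UNIV. A $ i $ p i)"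
  have "?t p = 0" if p: "p permutes UNIV" and "p \<noteq> id" for p
  proof -
    have "\<exists>i. A $ i $ p i = 0"
    proof (rule ccontr)
      assume "\<not> ?thesis"
      then have *: "p i \<noteq> i \<longrightarrow> \<rho> i < \<rho> (p i)" for i
        using tri by (metis linorder_not_le)
      then have le: "\<rho> i \<le> \<rho> (p i)" for i
        by (cases "p i = i") (auto intro: less_imp_le)
      from \<open>p \<noteq> id\<close> obtain i where "p i \<noteq> i"
        by (auto simp: fun_eq_iff)
      with * have "\<rho> i < \<rho> (p i)" by blast
      then have "(\<Sum>i\<in>UNIV. \<rho> i) < (\<Sum>i\<in>UNIV. \<rho> (p i))"
        using le by (intro sum_strict_mono_ex1) auto
      moreover have "(\<Sum>i\<in>UNIV. \<rho> (p i)) = (\<Sum>i\<in>UNIV. \<rho> i)"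
        using sum.permute[OF p, of \<rho>] by (simp add: o_def)
      ultimately show False by simp
    qed
    then obtain i where "A $ i $ p i = 0" ..
    then have "(\<Prod>i\<in>UNIV. A $ i $ p i) = 0"
      by (intro prod_zero) auto
    then show ?thesis by simp
  qed
  then have "det A = (\<Sum>p\<in>{id}. ?t p)"
    unfolding det_def
    by (intro sum.mono_neutral_right) (auto simp: permutes_id finite_permutations)
  then show ?thesis
    using diag by simp
qed

text \<open>\<open>m\<close> is a homomorphism from an additive group, so \<open>m (- v)\<close>
  inverts \<open>m v\<close>, and commutativity is inherited from addition.\<close>

lemma subgroup_range_hom_SL:
  fixes m :: "'p::ab_group_add \<Rightarrow> real^'n^'n"
  assumes det: "\<And>v. det (m v) = 1"
    and zero: "m 0 = mat 1" and add: "\<And>v w. m v ** m w = m (v + w)"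
  shows "subgroup (range m) SL" "comm_group (SL\<lparr>carrier := range m\<rparr>)"
proof -
  interpret group "SL :: (real^'n^'n) monoid" by (rule group_SL)
  have inv: "inv\<^bsub>SL\<^esub> (m v) = m (- v)" for v
    by (rule inv_equality) (auto simp: SL_def det add zero)
  show "subgroup (range m) SL"
    by (rule subgroupI) (auto simp: inv, auto simp: SL_def det add)
  then have "group (SL\<lparr>carrier := range m\<rparr>)"
    by (rule subgroup_imp_group)
  then show "comm_group (SL\<lparr>carrier := range m\<rparr>)"
    by (rule group.group_comm_groupI) (auto simp: SL_def add add.commute)
qed

text \<open>The continuous left inverse \<open>q\<close> makes \<open>m\<close> a homeomorphism onto
  its range. What remains is to translate between vectors of \<open>'p\<close> and their coordinate
  sequences.\<close>

lemma homeomorphic_space_range_Euclidean_space: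
  fixes m :: "'p::euclidean_space \<Rightarrow> 'a::t2_space"
  assumes m: "continuous_on UNIV m" and q: "continuous_on UNIV q" and qm: "\<And>v. q (m v) = v"
  shows "top_of_set (range m) homeomorphic_space Euclidean_space DIM('p)"
proof -
  obtain e where e: "bij_betw e {..<DIM('p)} (Basis :: 'p set)"
    using ex_bij_betw_nat_finite[OF finite_Basis] by (auto simp: atLeast0LessThan)
  let ?v = "\<lambda>x::nat \<Rightarrow> real. \<Sum>i<DIM('p). x i *\<^sub>R e i"
  \<comment> \<open>Points of \<open>Euclidean_space n\<close> are sequences that vanish from index
    \<open>n\<close> on, hence the default value 0.\<close>
  let ?f = "\<lambda>A i. if i < DIM('p) then q A \<bullet> e i else 0"
  have v_e: "?v x \<bullet> e j = x j" if "j < DIM('p)" for x j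
  proof -
    have "?v x \<bullet> e j = (\<Sum>i<DIM('p). if i = j then x j else 0)"
      unfolding inner_sum_left
    proof (rule sum.cong)
      fix i assume i: "i \<in> {..<DIM('p)}"
      have "e i \<in> Basis" "e j \<in> Basis" "e i = e j \<longleftrightarrow> i = j"
        using e i that by (auto simp: bij_betw_def inj_on_def)
      then show "x i *\<^sub>R e i \<bullet> e j = (if i = j then x j else 0)"
        by (simp add: inner_Basis)
    qed simp
    then show ?thesis
      using that by simp
  qed
  have e_v: "(\<Sum>i<DIM('p). (w \<bullet> e i) *\<^sub>R e i) = w" for w
    using sum.reindex_bij_betw[OF e, of "\<lambda>b. (w \<bullet> b) *\<^sub>R b"]
    by (simp add: euclidean_representation)
  have "continuous_map (top_of_set (range m)) (Euclidean_space DIM('p)) ?f"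
    unfolding continuous_map_componentwise_Euclidean_space
    by (auto intro!: continuous_intros continuous_on_subset[OF q])
  moreover have "continuous_on (topspace (Euclidean_space DIM('p))) (\<lambda>x. m (?v x))"
  proof (rule continuous_on_subset)
    have "continuous_on UNIV (\<lambda>x::nat \<Rightarrow> real. x i)" for i
      by simp
    then have "continuous_on UNIV ?v"
      by (intro continuous_intros)
    then show "continuous_on UNIV (\<lambda>x. m (?v x))"
      by (rule continuous_on_compose2[OF m]) simp
  qed simp
  then have "continuous_map (Euclidean_space DIM('p)) euclidean (\<lambda>x. m (?v x))"
    by (simp add: continuous_map_Euclidean_space_iff)
  ultimately have "homeomorphic_maps (top_of_set (range m)) (Euclidean_space DIM('p)) ?f
      (\<lambda>x. m (?v x))"
    by (auto simp: homeomorphic_maps_def continuous_map_in_subtopology qm e_v v_e fun_eq_iff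
        topspace_Euclidean_space)
  then show ?thesis
    by (rule homeomorphic_maps_imp_homeomorphic_space)
qed

text \<open>Closedness comes from writing the range as the set of fixed points of the continuous map
  sending \<open>A\<close> to \<open>m (q A)\<close>.\<close>

lemma has_lie_dimension_range:
  fixes m :: "'p::euclidean_space \<Rightarrow> real^'n^'n"
  assumes sub: "subgroup (range m) SL"
    and m: "continuous_on UNIV m" and q: "continuous_on UNIV q" and qm: "\<And>v. q (m v) = v"
  shows "has_lie_dimension (range m) DIM('p)"
proof -
  have "range m = {A. m (q A) = A}"
    using qm by (auto, metis rangeI)
  moreover have "closed {A. m (q A) = A}"
    by (intro closed_Collect_eq continuous_on_compose2[OF m q] continuous_on_id) simp
  ultimately have "closedin (top_of_set (carrier SL)) (range m)"
    using subgroup.subset[OF sub] by (simp add: closed_subset)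
  \<comment> \<open>One global chart serves every point: \<open>U\<close> is the whole range and
    \<open>V\<close> the whole Euclidean space.\<close>
  moreover have "\<exists>U V. openin (top_of_set (range m)) U \<and> x \<in> U \<and>
      openin (Euclidean_space DIM('p)) V \<and>
      top_of_set U homeomorphic_space subtopology (Euclidean_space DIM('p)) V"
    if "x \<in> range m" for x
    using that homeomorphic_space_range_Euclidean_space[OF m q qm]
    by (intro exI[of _ "range m"] exI[of _ "topspace (Euclidean_space DIM('p))"])
      (simp add: subtopology_topspace)
  ultimately show ?thesis
    using sub by (auto simp: has_lie_dimension_def)
qed

section \<open>The two groups\<close>

lemma exhaust_5: "x = 1 \<or> x = 2 \<or> x = 3 \<or> x = 4 \<or> x = 5" for x :: 5
proof (induct x)
  case (of_int z)
  \<comment> \<open>Arithmetic in type \<open>5\<close> is modulo 5, so the representative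
    \<open>z = 0\<close> yields the case \<open>x = 5\<close>.\<close>
  then have "z = 0 \<or> z = 1 \<or> z = 2 \<or> z = 3 \<or> z = 4" by fastforce
  then show ?case by auto
qed

lemma exhaust_6: "x = 1 \<or> x = 2 \<or> x = 3 \<or> x = 4 \<or> x = 5 \<or> x = 6" for x :: 6
proof (induct x)
  case (of_int z)
  then have "z = 0 \<or> z = 1 \<or> z = 2 \<or> z = 3 \<or> z = 4 \<or> z = 5" by fastforce
  then show ?case by auto
qed

lemma forall_5: "(\<forall>i::5. P i) \<longleftrightarrow> P 1 \<and> P 2 \<and> P 3 \<and> P 4 \<and> P 5"
  by (metis exhaust_5)

lemma forall_6: "(\<forall>i::6. P i) \<longleftrightarrow> P 1 \<and> P 2 \<and> P 3 \<and> P 4 \<and> P 5 \<and> P 6"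
  by (metis exhaust_6)

lemma sum_5: "sum f (UNIV :: 5 set) = f 1 + f 2 + f 3 + f 4 + f 5"
proof -
  have *: "UNIV = {1, 2, 3, 4, 5 :: 5}"
    using exhaust_5 by auto
  show ?thesis
    unfolding * by (simp add: ac_simps)
qed

lemma sum_6: "sum f (UNIV :: 6 set) = f 1 + f 2 + f 3 + f 4 + f 5 + f 6"
proof -
  have *: "UNIV = {1, 2, 3, 4, 5, 6 :: 6}"
    using exhaust_6 by auto
  show ?thesis
    unfolding * by (simp add: ac_simps)
qed

lemma vector_5 [simp]:
  fixes a b c d e :: "'a::zero"
  defines "v \<equiv> vector [a, b, c, d, e] :: 'a^5"
  shows "v $ 1 = a" "v $ 2 = b" "v $ 3 = c" "v $ 4 = d" "v $ 5 = e"
  by (simp_all add: v_def vector_def)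

lemma vector_6 [simp]:
  fixes a b c d e f :: "'a::zero"
  defines "v \<equiv> vector [a, b, c, d, e, f] :: 'a^6"
  shows "v $ 1 = a" "v $ 2 = b" "v $ 3 = c" "v $ 4 = d" "v $ 5 = e" "v $ 6 = f"
  by (simp_all add: v_def vector_def)

lemma continuous_on_matrixI:
  fixes m :: "'a::topological_space \<Rightarrow> real^'n^'k"
  assumes "\<forall>i j. continuous_on S (\<lambda>x. m x $ i $ j)"
  shows "continuous_on S m"
proof -
  have "continuous_on S (\<lambda>x. \<chi> i j. m x $ i $ j)"
    using assms by (intro continuous_on_vec_lambda) auto
  then show ?thesis by simp
qed

section \<open>Parametrisation of the two groups by additive groups of tuples\<close>

definition mat5 :: "real \<times> real \<times> real \<times> real \<Rightarrow> real^5^5" where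
  "mat5 = (\<lambda>(a, b, c, d).
     vector [vector [1, a, 0, a\<^sup>2 / 2, b],
             vector [0, 1, 0, a,       0],
             vector [0, 0, 1, c,       d],
             vector [0, 0, 0, 1,       0],
             vector [0, 0, 0, 0,       1]])"

definition mat6 :: "real \<times> real \<times> real \<times> real \<times> real \<Rightarrow> real^6^6" where
  "mat6 = (\<lambda>(a, b, c, d, e).
     vector [vector [1, a, a\<^sup>2 / 2, 0, b, c],
             vector [0, 1, a,       0, 0, 0],
             vector [0, 0, 1,       0, 0, 0],
             vector [0, 0, 0,       1, d, e],
             vector [0, 0, 0,       0, 1, 0],
             vector [0, 0, 0,       0, 0, 1]])"

text \<open>Packing the parameters into a tuple gives a domain that is both an additive group and a
  Euclidean space, so the general results on ranges apply.\<close>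

lemma M5_eq_range: "M5 = range mat5"
  by (auto simp: M5_def mat5_def image_def)

lemma M6_eq_range: "M6 = range mat6"
  by (auto simp: M6_def mat6_def image_def)

lemma det_mat5: "det (mat5 v) = 1"
proof (rule det_unitriangular)
  \<comment> \<open>The levels are chosen so that each off-diagonal entry that can be nonzero leads
    from a row to a column of strictly higher level: 1 and 3 lie lowest, then 2, then 4 and
    5.\<close>
  let ?\<rho> = "\<lambda>i::5. if i = 1 \<or> i = 3 then 0 else if i = 2 then 1 else 2 :: nat"
  show "mat5 v $ i $ i = 1" for i
    using exhaust_5[of i] by (auto simp: mat5_def split: prod.split)
  have "\<forall>i j. i \<noteq> j \<longrightarrow> ?\<rho> j \<le> ?\<rho> i \<longrightarrow> mat5 v $ i $ j = 0"
    unfolding forall_5 by (simp add: mat5_def split: prod.split)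
  then show "mat5 v $ i $ j = 0" if "i \<noteq> j" "?\<rho> j \<le> ?\<rho> i" for i j
    using that by blast
qed

lemma det_mat6: "det (mat6 v) = 1"
proof (rule det_unitriangular)
  \<comment> \<open>Here 1 and 4 lie lowest, then 2, then 3, 5 and 6.\<close>
  let ?\<rho> = "\<lambda>i::6. if i = 1 \<or> i = 4 then 0 else if i = 2 then 1 else 2 :: nat"
  show "mat6 v $ i $ i = 1" for i
    using exhaust_6[of i] by (auto simp: mat6_def split: prod.split)
  have "\<forall>i j. i \<noteq> j \<longrightarrow> ?\<rho> j \<le> ?\<rho> i \<longrightarrow> mat6 v $ i $ j = 0"
    unfolding forall_6 by (simp add: mat6_def split: prod.split)
  then show "mat6 v $ i $ j = 0" if "i \<noteq> j" "?\<rho> j \<le> ?\<rho> i" for i j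
    using that by blast
qed

lemma mat5_0: "mat5 0 = mat 1"
  by (simp add: vec_eq_iff forall_5 mat_def mat5_def zero_prod_def)

lemma mat6_0: "mat6 0 = mat 1"
  by (simp add: vec_eq_iff forall_6 mat_def mat6_def zero_prod_def)

text \<open>The linear parameters simply add. The quadratic entry is consistent because
  \<open>a\<^sup>2 / 2 + a * a' + a'\<^sup>2 / 2\<close> equals \<open>(a + a')\<^sup>2 / 2\<close>,
  the cross term coming from the two entries \<open>a\<close> and \<open>a'\<close>.\<close>

lemma mat5_add: "mat5 v ** mat5 w = mat5 (v + w)"
  by (cases v; cases w)
    (simp add: vec_eq_iff forall_5 matrix_matrix_mult_def sum_5 mat5_def power2_eq_square
      field_simps)

lemma mat6_add: "mat6 v ** mat6 w = mat6 (v + w)"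
  by (cases v; cases w)
    (simp add: vec_eq_iff forall_6 matrix_matrix_mult_def sum_6 mat6_def power2_eq_square
      field_simps)

lemmas M5_group = subgroup_range_hom_SL[of mat5, OF det_mat5 mat5_0 mat5_add, folded M5_eq_range]

lemmas M6_group = subgroup_range_hom_SL[of mat6, OF det_mat6 mat6_0 mat6_add, folded M6_eq_range]

lemma has_lie_dimension_M5: "has_lie_dimension M5 4"
proof -
  \<comment> \<open>Each parameter is read off from a position where it stands alone, which gives a
    continuous left inverse of \<open>mat5\<close>.\<close>
  let ?q = "\<lambda>A::real^5^5. (A $ 1 $ 2, A $ 1 $ 5, A $ 3 $ 4, A $ 3 $ 5)"
  have "continuous_on UNIV mat5"
    by (rule continuous_on_matrixI)
      (simp add: forall_5 mat5_def case_prod_unfold, intro conjI continuous_intros, simp)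
  moreover have "continuous_on UNIV ?q"
    by (intro continuous_intros)
  moreover have "?q (mat5 v) = v" for v
    by (cases v) (simp add: mat5_def)
  ultimately have "has_lie_dimension (range mat5) DIM(real \<times> real \<times> real \<times> real)"
    using M5_group(1) by (intro has_lie_dimension_range) (auto simp: M5_eq_range)
  then show ?thesis
    by (simp add: M5_eq_range eval_nat_numeral)
qed

lemma has_lie_dimension_M6: "has_lie_dimension M6 5"
proof -
  let ?q = "\<lambda>A::real^6^6. (A $ 1 $ 2, A $ 1 $ 5, A $ 1 $ 6, A $ 4 $ 5, A $ 4 $ 6)"
  have "continuous_on UNIV mat6"
    by (rule continuous_on_matrixI)
      (simp add: forall_6 mat6_def case_prod_unfold, intro conjI continuous_intros, simp)
  moreover have "continuous_on UNIV ?q"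
    by (intro continuous_intros)
  moreover have "?q (mat6 v) = v" for v
    by (cases v) (simp add: mat6_def)
  ultimately have "has_lie_dimension (range mat6) DIM(real \<times> real \<times> real \<times> real \<times> real)"
    using M6_group(1) by (intro has_lie_dimension_range) (auto simp: M6_eq_range)
  then show ?thesis
    by (simp add: M6_eq_range eval_nat_numeral)
qed

section \<open>Lower bounds for the spans of the two groups\<close>

lemma dim_M5_ge: "6 \<le> dim M5"
proof -
  let ?f = "\<lambda>A::real^5^5. (A $ 1 $ 1, A $ 1 $ 2, A $ 1 $ 4, A $ 1 $ 5, A $ 3 $ 4, A $ 3 $ 5)"
  have "DIM(real \<times> real \<times> real \<times> real \<times> real \<times> real) \<le> dim M5"
  proof (rule dim_ge_of_no_linear_relation)
    show "linear ?f"
      by (rule linearI) simp_all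
    fix v assume v: "\<And>x. x \<in> M5 \<Longrightarrow> v \<bullet> ?f x = 0"
    obtain v1 v2 v3 v4 v5 v6 where [simp]: "v = (v1, v2, v3, v4, v5, v6)"
      by (metis prod.exhaust)
    have *: "v1 + v2 * a + v3 * (a\<^sup>2 / 2) + v4 * b + v5 * c + v6 * d = 0" for a b c d
      using v[of "mat5 (a, b, c, d)", unfolded M5_eq_range, OF rangeI]
      by (simp add: mat5_def algebra_simps)
    \<comment> \<open>The origin kills \<open>v1\<close>. The points \<open>a = 1\<close> and
      \<open>a = -1\<close> give \<open>v2 + v3 / 2 = 0\<close> and
      \<open>- v2 + v3 / 2 = 0\<close>, separating the linear from the quadratic term. The remaining
      unit vectors kill one coefficient each.\<close>
    show "v = 0"
      using *[of 0 0 0 0] *[of 1 0 0 0] *[of "-1" 0 0 0] *[of 0 1 0 0] *[of 0 0 1 0] *[of 0 0 0 1]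
      by (simp add: zero_prod_def)
  qed
  then show ?thesis by simp
qed

lemma dim_M6_ge: "7 \<le> dim M6"
proof -
  let ?f = "\<lambda>A::real^6^6.
    (A $ 1 $ 1, A $ 1 $ 2, A $ 1 $ 3, A $ 1 $ 5, A $ 1 $ 6, A $ 4 $ 5, A $ 4 $ 6)"
  have "DIM(real \<times> real \<times> real \<times> real \<times> real \<times> real \<times> real) \<le> dim M6"
  proof (rule dim_ge_of_no_linear_relation)
    show "linear ?f"
      by (rule linearI) simp_all
    fix v assume v: "\<And>x. x \<in> M6 \<Longrightarrow> v \<bullet> ?f x = 0"
    obtain v1 v2 v3 v4 v5 v6 v7 where [simp]: "v = (v1, v2, v3, v4, v5, v6, v7)"
      by (metis prod.exhaust)
    have *: "v1 + v2 * a + v3 * (a\<^sup>2 / 2) + v4 * b + v5 * c + v6 * d + v7 * e = 0" for a b c d e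
      using v[of "mat6 (a, b, c, d, e)", unfolded M6_eq_range, OF rangeI]
      by (simp add: mat6_def algebra_simps)
    \<comment> \<open>The same evaluation points work, with one further unit vector for the extra
      parameter \<open>e\<close>.\<close>
    show "v = 0"
      using *[of 0 0 0 0 0] *[of 1 0 0 0 0] *[of "-1" 0 0 0 0] *[of 0 1 0 0 0]
        *[of 0 0 1 0 0] *[of 0 0 0 1 0] *[of 0 0 0 0 1]
      by (simp add: zero_prod_def)
  qed
  then show ?thesis by simp
qed

theorem mainTheorem3:
  "(subgroup M5 SL \<and> comm_group (SL\<lparr>carrier := M5\<rparr>) \<and> has_lie_dimension M5 4 \<and>
      \<not> conjugacy_limit positive_diagonal M5) \<and>
   (subgroup M6 SL \<and> comm_group (SL\<lparr>carrier := M6\<rparr>) \<and> has_lie_dimension M6 5 \<and>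
      \<not> conjugacy_limit positive_diagonal M6)"
proof -
  have "\<not> conjugacy_limit positive_diagonal M5"
    using dim_conjugacy_limit_le[of M5] dim_M5_ge by auto
  moreover have "\<not> conjugacy_limit positive_diagonal M6"
    using dim_conjugacy_limit_le[of M6] dim_M6_ge by auto
  ultimately show ?thesis
    by (simp add: M5_group M6_group has_lie_dimension_M5 has_lie_dimension_M6)
qed

end
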